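(* Let $\psi\in\Omega$ satisfy $$\lim_{t\to\infty}\frac{\psi(2t)}{\psi(t)}=1.$$ A positive operator $T\in\mathcal M_\psi$ is Dixmier measurable if and only if the limit $$\lim_{n\to\infty}\frac{1}{\psi(n+1)}\sum_{k=0}^n\mu(k,T)$$ exists.
   Context: Notation: $H$ is an infinite-dimensional separable Hilbert space and $B(H)$ is the algebra of bounded linear operators on $H$. For a compact operator $T\in B(H)$, $\mu(k,T)$, $k=0,1,2,\ldots$, denotes the $k$-th singular value of $T$, i.e. the eigenvalues of $|T|$ arranged in decreasing order counted with multiplicity, starting with index $0$. $\Omega$ is the set of all concave functions $\psi:[0,\infty)\to[0,\infty)$ with $\lim_{t\to0+}\psi(t)=0$ and $\lim_{t\to\infty}\psi(t)=\infty$. For $\psi\in\Omega$, the Marcinkiewicz ideal $\mathcal M_\psi$ is the set of all compact operators $T\in B(H)$ with $$\|T\|_{\mathcal M_\psi}:=\sup_{n\ge0}\frac{1}{\psi(1+n)}\sum_{k=0}^n\mu(k,T)<\infty.$$ Generalized limits: $l_\infty$ is the space of bounded sequences $x=(x_0,x_1,\ldots)$ with the sup norm. A generalized limit on $l_\infty$ is a normalized positive linear functional on $l_\infty$ which equals the ordinary limit on convergent sequences. For $n\in\mathbb N$ (so $n\ge1$) the dilation operator $\sigma_n:l_\infty\to l_\infty$ is $$\sigma_n(x_0,x_1,\ldots)=(\underbrace{x_0,\ldots,x_0}_{n},\underbrace{x_1,\ldots,x_1}_{n},\ldots).$$ A generalized limit $\omega$ on $l_\infty$ is dilation invariant if $\omega(\sigma_n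 x)=\omega(x)$ for all $x\in l_\infty$ and all $n\in\mathbb N$. Dixmier traces: let $\psi\in\Omega$ satisfy $\liminf_{t\to\infty}\psi(2t)/\psi(t)=1$. For every dilation invariant generalized limit $\omega$ on $l_\infty$ satisfying $\omega\left(\left\{\frac{\psi(2n)}{\psi(n)}\right\}_n\right)=1$ (the value assigned to the term $n=0$ is immaterial), the weight $${\rm Tr}_\omega(T):=\omega\left(\left\{\frac{1}{\psi(1+n)}\sum_{k=0}^n\mu(k,T)\right\}_{n=0}^\infty\right),\quad 0\le T\in\mathcal M_\psi,$$ extends by linearity to a trace on $\mathcal M_\psi$, called a Dixmier trace. $\mathcal D$ is the set of all Dixmier traces on $\mathcal M_\psi$. An operator $T\in\mathcal M_\psi$ is called Dixmier measurable if ${\rm Tr}_\omega(T)$ takes the same value for all ${\rm Tr}_\omega\in\mathcal D$. *)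

theory Defs
  imports "HOL-Analysis.Analysis"
begin

text \<open>
  HOL-Analysis has only real inner product spaces. A complex Hilbert space is a complete real one
  carrying a compatible complex structure and a sesquilinear form (linear in the first argument)
  whose real part is the real inner product; hence \<open>norm x = sqrt (Re (cinner x x))\<close>.
\<close>

class complex_hilbert_space = real_inner + complete_space +
  fixes scaleC :: "complex \<Rightarrow> 'a \<Rightarrow> 'a" (infixr "*\<^sub>C" 75)
    and cinner :: "'a \<Rightarrow> 'a \<Rightarrow> complex"
  assumes scaleC_add_right: "c *\<^sub>C (x + y) = c *\<^sub>C x + c *\<^sub>C y"
    and scaleC_add_left: "(c + d) *\<^sub>C x = c *\<^sub>C x + d *\<^sub>C x"
    and scaleC_scaleC: "c *\<^sub>C d *\<^sub>C x = (c * d) *\<^sub>C x"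
    and scaleC_one: "1 *\<^sub>C x = x"
    and scaleR_scaleC: "r *\<^sub>R x = complex_of_real r *\<^sub>C x"
    and cinner_commute: "cinner x y = cnj (cinner y x)"
    and cinner_add_left: "cinner (x + y) z = cinner x z + cinner y z"
    and cinner_scaleC_left: "cinner (c *\<^sub>C x) y = c * cinner x y"
    and inner_eq_Re_cinner: "inner x y = Re (cinner x y)"

global_interpretation complex_vector:
  vector_space "scaleC :: complex \<Rightarrow> 'a \<Rightarrow> 'a::complex_hilbert_space"
  defines cspan = complex_vector.span and cdim = complex_vector.dim
  by unfold_locales (simp_all add: scaleC_add_right scaleC_add_left scaleC_scaleC scaleC_one)

subsection \<open>Operators\<close>

definition bounded_clinear :: "('h::complex_hilbert_space \<Rightarrow> 'h) \<Rightarrow> bool" where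
  "bounded_clinear T \<longleftrightarrow> bounded_linear T \<and> (\<forall>c x. T (c *\<^sub>C x) = c *\<^sub>C T x)"

definition compact_op :: "('h::complex_hilbert_space \<Rightarrow> 'h) \<Rightarrow> bool" where
  "compact_op T \<longleftrightarrow> bounded_clinear T \<and> compact (closure (T ` cball 0 1))"

definition positive_op :: "('h::complex_hilbert_space \<Rightarrow> 'h) \<Rightarrow> bool" where
  "positive_op T \<longleftrightarrow> bounded_clinear T \<and> (\<forall>x. cinner (T x) x \<in> \<real>\<^sub>\<ge>\<^sub>0)"

definition adj :: "('h::complex_hilbert_space \<Rightarrow> 'h) \<Rightarrow> 'h \<Rightarrow> 'h" where
  "adj T = (THE S. bounded_clinear S \<and> (\<forall>x y. cinner (T x) y = cinner x (S y)))"

definition abs_op :: "('h::complex_hilbert_space \<Rightarrow> 'h) \<Rightarrow> 'h \<Rightarrow> 'h" where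
  "abs_op T = (THE S. positive_op S \<and> S \<circ> S = adj T \<circ> T)"

definition eigenspace :: "('h::complex_hilbert_space \<Rightarrow> 'h) \<Rightarrow> complex \<Rightarrow> 'h set" where
  "eigenspace A l = {x. A x = l *\<^sub>C x}"

text \<open>
  A nonincreasing sequence in \<open>[0, \<infinity>)\<close> is the list of eigenvalues of \<open>|T|\<close> when each \<open>l > 0\<close> occurs in
  it as often as its multiplicity (possibly \<open>0\<close>). This determines the sequence: if \<open>T\<close> has finite
  rank, the list is continued by zeros; otherwise, as usual, the eigenvalue \<open>0\<close> does not occur in it.
  Finiteness is stated separately because \<^const>\<open>card\<close> sends infinite sets to \<open>0\<close>.
\<close>

definition singular_value :: "nat \<Rightarrow> ('h::complex_hilbert_space \<Rightarrow> 'h) \<Rightarrow> real" where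
  "singular_value k T = (THE m. decseq m \<and> (\<forall>j. 0 \<le> m j) \<and>
     (\<forall>l>0. finite {j. m j = l} \<and>
            card {j. m j = l} = cdim (eigenspace (abs_op T) (complex_of_real l)))) k"

subsection \<open>Marcinkiewicz ideals\<close>

definition Omega :: "(real \<Rightarrow> real) set" where
  "Omega = {\<psi>. concave_on {0..} \<psi> \<and> (\<forall>t\<ge>0. 0 \<le> \<psi> t) \<and>
     (\<psi> \<longlongrightarrow> 0) (at_right 0) \<and> filterlim \<psi> at_top at_top}"

definition singular_mean ::
    "(real \<Rightarrow> real) \<Rightarrow> ('h::complex_hilbert_space \<Rightarrow> 'h) \<Rightarrow> nat \<Rightarrow> real" where
  "singular_mean \<psi> T n = 1 / \<psi> (1 + real n) * (\<Sum>k=0..n. singular_value k T)"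

definition marcinkiewicz_norm ::
    "(real \<Rightarrow> real) \<Rightarrow> ('h::complex_hilbert_space \<Rightarrow> 'h) \<Rightarrow> ereal" where
  "marcinkiewicz_norm \<psi> T = (SUP n. ereal (singular_mean \<psi> T n))"

definition marcinkiewicz :: "(real \<Rightarrow> real) \<Rightarrow> ('h::complex_hilbert_space \<Rightarrow> 'h) set" where
  "marcinkiewicz \<psi> = {T. compact_op T \<and> marcinkiewicz_norm \<psi> T < \<infinity>}"

subsection \<open>Generalized limits\<close>

text \<open>
  A functional on \<open>l\<^sub>\<infinity>\<close> is a function on all real sequences, of which only the values on bounded
  sequences (\<^const>\<open>Bseq\<close>) matter.
\<close>

definition generalized_limit :: "((nat \<Rightarrow> real) \<Rightarrow> real) \<Rightarrow> bool" where
  "generalized_limit \<omega> \<longleftrightarrow>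
     (\<forall>x y. Bseq x \<longrightarrow> Bseq y \<longrightarrow> \<omega> (\<lambda>n. x n + y n) = \<omega> x + \<omega> y) \<and>
     (\<forall>c x. Bseq x \<longrightarrow> \<omega> (\<lambda>n. c * x n) = c * \<omega> x) \<and>
     (\<forall>x. Bseq x \<longrightarrow> (\<forall>n. 0 \<le> x n) \<longrightarrow> 0 \<le> \<omega> x) \<and>
     \<omega> (\<lambda>_. 1) = 1 \<and>
     (\<forall>x l. x \<longlonglongrightarrow> l \<longrightarrow> \<omega> x = l)"

definition dilation :: "nat \<Rightarrow> (nat \<Rightarrow> real) \<Rightarrow> nat \<Rightarrow> real" where
  "dilation n x = (\<lambda>k. x (k div n))"

definition dilation_invariant :: "((nat \<Rightarrow> real) \<Rightarrow> real) \<Rightarrow> bool" where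
  "dilation_invariant \<omega> \<longleftrightarrow> (\<forall>n\<ge>1. \<forall>x. Bseq x \<longrightarrow> \<omega> (dilation n x) = \<omega> x)"

subsection \<open>Dixmier traces\<close>

text \<open>The term \<open>n = 0\<close> of the sequence below is \<open>0 / 0 = 0\<close>; its value is immaterial.\<close>

definition admissible :: "(real \<Rightarrow> real) \<Rightarrow> ((nat \<Rightarrow> real) \<Rightarrow> real) \<Rightarrow> bool" where
  "admissible \<psi> \<omega> \<longleftrightarrow> generalized_limit \<omega> \<and> dilation_invariant \<omega> \<and>
     \<omega> (\<lambda>n. \<psi> (2 * real n) / \<psi> (real n)) = 1"

definition dixmier_weight ::
    "(real \<Rightarrow> real) \<Rightarrow> ((nat \<Rightarrow> real) \<Rightarrow> real) \<Rightarrow> ('h::complex_hilbert_space \<Rightarrow> 'h) \<Rightarrow> real" where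
  "dixmier_weight \<psi> \<omega> T = \<omega> (singular_mean \<psi> T)"

definition re_op :: "('h::complex_hilbert_space \<Rightarrow> 'h) \<Rightarrow> 'h \<Rightarrow> 'h" where
  "re_op T = (\<lambda>x. (1 / 2) *\<^sub>C (T x + adj T x))"

definition im_op :: "('h::complex_hilbert_space \<Rightarrow> 'h) \<Rightarrow> 'h \<Rightarrow> 'h" where
  "im_op T = (\<lambda>x. (1 / (2 * \<i>)) *\<^sub>C (T x - adj T x))"

definition pos_part :: "('h::complex_hilbert_space \<Rightarrow> 'h) \<Rightarrow> 'h \<Rightarrow> 'h" where
  "pos_part A = (\<lambda>x. (1 / 2) *\<^sub>C (abs_op A x + A x))"

definition neg_part :: "('h::complex_hilbert_space \<Rightarrow> 'h) \<Rightarrow> 'h \<Rightarrow> 'h" where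
  "neg_part A = (\<lambda>x. (1 / 2) *\<^sub>C (abs_op A x - A x))"

text \<open>
  The linear extension of the weight from the positive cone to the whole ideal, evaluated on the
  decomposition of \<open>T\<close> as \<open>(Re T)\<^sub>+ - (Re T)\<^sub>- + \<i> ((Im T)\<^sub>+ - (Im T)\<^sub>-)\<close> into positive operators.
\<close>

definition dixmier_trace ::
    "(real \<Rightarrow> real) \<Rightarrow> ((nat \<Rightarrow> real) \<Rightarrow> real) \<Rightarrow> ('h::complex_hilbert_space \<Rightarrow> 'h) \<Rightarrow> complex" where
  "dixmier_trace \<psi> \<omega> T = Complex
     (dixmier_weight \<psi> \<omega> (pos_part (re_op T)) - dixmier_weight \<psi> \<omega> (neg_part (re_op T)))
     (dixmier_weight \<psi> \<omega> (pos_part (im_op T)) - dixmier_weight \<psi> \<omega> (neg_part (im_op T)))"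

definition dixmier_traces ::
    "(real \<Rightarrow> real) \<Rightarrow> (('h::complex_hilbert_space \<Rightarrow> 'h) \<Rightarrow> complex) set" where
  "dixmier_traces \<psi> = {dixmier_trace \<psi> \<omega> | \<omega>. admissible \<psi> \<omega>}"

definition dixmier_measurable ::
    "(real \<Rightarrow> real) \<Rightarrow> ('h::complex_hilbert_space \<Rightarrow> 'h) \<Rightarrow> bool" where
  "dixmier_measurable \<psi> T \<longleftrightarrow> T \<in> marcinkiewicz \<psi> \<and>
     (\<exists>c. \<forall>\<tau> \<in> dixmier_traces \<psi>. \<tau> T = c)"

end

theory Submission
  imports Defs
begin

text \<open>
  If the means converge to \<open>l\<close>, every generalized limit assigns \<open>l\<close> to them, so all Dixmier traces
  agree at \<open>T\<close>. The content is the converse, and it rests on one observation. Write \<open>A n\<close> for the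
  partial sums of the singular values and \<open>x n = A n / \<psi> (1 + n)\<close> for the means. As \<open>A\<close> increases and
  \<open>\<psi>\<close> is slowly varying, \<open>x j \<le> (1 + \<delta>) * x k\<close> whenever \<open>j \<le> k \<le> M * j\<close> and \<open>j\<close> is large
  (\<open>singular_mean_almost_increasing\<close>). So a value of \<open>x\<close> well above a number \<open>c\<close> keeps \<open>x\<close> above \<open>c\<close>
  on a long window to its right, and a value well below \<open>c\<close> keeps \<open>x\<close> below \<open>c\<close> on a long window to its
  left. Here long means that the ratio of the end points is as large as desired.

  Such windows carry dilation invariant generalized limits. The mean over \<open>{a..b}\<close> with weights
  \<open>1 / k\<close> changes under a dilation only by a bounded multiple of \<open>1 / ln (b / a)\<close>, because the weights
  come from the scale invariant measure \<open>dt / t\<close>; a cluster point of these means, which exists by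
  Tychonoff's theorem, is therefore a dilation invariant generalized limit that sees only the windows
  (\<open>dilation_invariant_limit_on_windows\<close>). If \<open>x\<close> did not converge to the common value \<open>c\<close> of all
  dilation invariant limits, one of the two kinds of windows would give such a limit with a value
  different from \<open>c\<close> (\<open>convergent_if_dilation_invariant_limits_agree\<close>). All these limits define Dixmier
  traces, since \<open>\<psi> (2 * n) / \<psi> n\<close> converges to \<open>1\<close>.

  It remains to identify the Dixmier trace of a positive \<open>T\<close> with \<open>\<omega>\<close> at its means, and the singular
  values with a nonnegative sequence. The first amounts to \<open>|T| = T\<close>, that is, to the uniqueness of
  positive square roots (\<open>abs_op_positive_op\<close>). The second is the existence and the uniqueness of the
  decreasing list of eigenvalues with multiplicities, for which it suffices that a compact positive
  operator has only finitely many eigenvalues above each \<open>e > 0\<close>.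
\<close>

section \<open>Dilation invariant limits carried by long windows\<close>

text \<open>
  This is Tychonoff's theorem: the functions \<open>L i\<close>, set to \<open>0\<close> outside \<open>Y\<close>, lie in a product of compact
  intervals and therefore have a cluster point. The filter \<open>F\<close> expresses convergence along a subnet, so
  that the usual limit rules apply to the cluster point.
\<close>

lemma cluster_function:
  fixes L :: "nat \<Rightarrow> 'a \<Rightarrow> real"
  assumes bd: "\<And>i y. y \<in> Y \<Longrightarrow> \<bar>L i y\<bar> \<le> B y"
  obtains \<omega> F where "F \<noteq> bot" "F \<le> sequentially"
    "\<And>y. y \<in> Y \<Longrightarrow> ((\<lambda>i. L i y) \<longlongrightarrow> \<omega> y) F"
proof -
  define L' where "L' = (\<lambda>i y. if y \<in> Y then L i y else 0)"
  define K where "K = PiE UNIV (\<lambda>y. cball (0::real) (if y \<in> Y then B y else 0))"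
  have "compactin (product_topology (\<lambda>_. euclidean) UNIV) K"
    unfolding K_def by (subst compactin_PiE) simp
  then have K: "compact K"
    by (simp add: euclidean_product_topology compactin_euclidean_iff)
  have L'K: "L' i \<in> K" for i
    using bd by (auto simp: K_def L'_def)
  have "filtermap L' sequentially \<noteq> bot" by (simp add: filtermap_bot_iff)
  moreover have "eventually (\<lambda>f. f \<in> K) (filtermap L' sequentially)"
    using L'K by (simp add: eventually_filtermap)
  ultimately obtain \<omega> where \<omega>: "inf (nhds \<omega>) (filtermap L' sequentially) \<noteq> bot"
    using K unfolding compact_filter by blast
  \<comment> \<open>The indices at which \<open>L'\<close> is close to its cluster point.\<close>
  define F where "F = inf sequentially (filtercomap L' (nhds \<omega>))"
  have "F \<noteq> bot"
  proof
    assume "F = bot"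
    then have "eventually (\<lambda>_. False) F" by simp
    then obtain P Q where P: "eventually P sequentially"
      and Q: "eventually Q (filtercomap L' (nhds \<omega>))" and PQ: "\<And>i. P i \<Longrightarrow> Q i \<Longrightarrow> False"
      unfolding F_def eventually_inf by blast
    from Q obtain R where R: "eventually R (nhds \<omega>)" and RQ: "\<And>i. R (L' i) \<Longrightarrow> Q i"
      unfolding eventually_filtercomap by blast
    have "eventually (\<lambda>f. \<not> R f) (filtermap L' sequentially)"
      unfolding eventually_filtermap using P by eventually_elim (use PQ RQ in blast)
    with R have "eventually (\<lambda>_. False) (inf (nhds \<omega>) (filtermap L' sequentially))"
      unfolding eventually_inf by blast
    with \<omega> show False by (simp add: trivial_limit_def)
  qed
  have "filterlim L' (nhds \<omega>) F"
    unfolding filterlim_def F_def by (simp add: filtermap_le_iff_le_filtercomap)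
  then have L'_lim: "((\<lambda>i. L' i y) \<longlongrightarrow> \<omega> y) F" for y
    by (rule continuous_on_tendsto_compose[OF continuous_on_product_coordinates[of y]]) auto
  then have "((\<lambda>i. L i y) \<longlongrightarrow> \<omega> y) F" if "y \<in> Y" for y
    using that L'_lim[of y] by (simp add: L'_def)
  with \<open>F \<noteq> bot\<close> show thesis by (intro that[of F]) (auto simp: F_def)
qed

definition log_mean :: "nat \<Rightarrow> nat \<Rightarrow> (nat \<Rightarrow> real) \<Rightarrow> real" where
  "log_mean a b y = (\<Sum>k=a..b. y k / real k) / (\<Sum>k=a..b. 1 / real k)"

text \<open>
  The preimage of \<open>j\<close> under division by \<open>n\<close> has total weight close to the weight \<open>1 / j\<close> of \<open>j\<close> itself;
  the bound is written as a difference so that it telescopes when summed over \<open>j\<close>.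
\<close>

lemma block_reciprocal:
  assumes "j \<ge> 1" "n \<ge> 1"
  shows "\<bar>(\<Sum>r<n. 1 / real (n * j + r)) - 1 / j\<bar> \<le> 1 / j - 1 / (real j + 1)"
proof -
  have "(\<Sum>r<n. 1 / real (n * j + r)) \<le> (\<Sum>r<n. 1 / (real n * j))"
    using assms by (intro sum_mono frac_le) (auto simp: field_simps)
  also have "\<dots> = 1 / j" using assms by simp
  finally have up: "(\<Sum>r<n. 1 / real (n * j + r)) \<le> 1 / j" .
  have "1 / (real j + 1) = (\<Sum>r<n. 1 / (real n * (j + 1)))" using assms by simp
  also have "\<dots> \<le> (\<Sum>r<n. 1 / real (n * j + r))"
    using assms by (intro sum_mono frac_le) (auto simp: algebra_simps intro!: add_nonneg_pos)
  finally show ?thesis using up by linarith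
qed

lemma sum_dilation_blocks:
  fixes f :: "nat \<Rightarrow> nat \<Rightarrow> real"
  shows "(\<Sum>k<n * q. f (k div n) k) = (\<Sum>j<q. \<Sum>r<n. f j (n * j + r))"
proof (induction q)
  case (Suc q)
  have "{..<n * Suc q} = {..<n * q} \<union> {n * q..<n * q + n}" by auto
  then have "(\<Sum>k<n * Suc q. f (k div n) k)
      = (\<Sum>k<n * q. f (k div n) k) + (\<Sum>k=n * q..<n * q + n. f (k div n) k)"
    by (simp add: sum.union_disjoint ivl_disj_int)
  also have "(\<Sum>k=n * q..<n * q + n. f (k div n) k) = (\<Sum>r<n. f q (n * q + r))"
    by (rule sum.reindex_bij_witness[of _ "\<lambda>r. n * q + r" "\<lambda>k. k - n * q"])
       (auto simp: div_nat_eqI mult.commute)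
  finally show ?case by (simp add: Suc)
qed simp

text \<open>
  Invariance of \<open>dt / t\<close> under dilations, in discrete form. Blocks of length \<open>n\<close> compare the dilated sum
  up to \<open>N\<close> with the original sum up to \<open>N div n\<close>. What is left are the sums from \<open>N div n\<close> to \<open>N\<close>, whose
  weights add up to a number that depends on \<open>n\<close> only. The terms at \<open>0\<close> vanish by \<open>y / 0 = 0\<close>.
\<close>

lemma sum_dilation_near_sum:
  fixes y :: "nat \<Rightarrow> real"
  assumes B: "\<And>k. \<bar>y k\<bar> \<le> B" and n: "n \<ge> 1"
  shows "\<bar>(\<Sum>k<N. y (k div n) / k) - (\<Sum>k<N. y k / k)\<bar> \<le> B * (4 * n + 1)"
proof -
  define q where "q = N div n"
  define S where "S = (\<lambda>N::nat. \<Sum>k<N. y k / k)"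
  define S' where "S' = (\<lambda>N::nat. \<Sum>k<N. y (k div n) / k)"
  have B0: "0 \<le> B" using B[of 0] by linarith
  have term_le: "\<bar>y i / real k\<bar> \<le> B" for i k
  proof (cases "k = 0")
    case False
    then have "\<bar>y i\<bar> / real k \<le> \<bar>y i\<bar> / 1" by (intro divide_left_mono) auto
    then show ?thesis using B[of i] by simp
  qed (use B0 in simp)
  \<comment> \<open>\<open>B * g j\<close> bounds the error of block \<open>j\<close>; in block \<open>0\<close> each of the \<open>n\<close> terms is at most \<open>B\<close>.\<close>
  define g where "g = (\<lambda>j::nat. if j = 0 then real n else 1 / j - 1 / (real j + 1))"
  have g_sum: "(\<Sum>j<Suc q. g j) = n + 1 - 1 / (real q + 1)" for q
    by (induction q) (simp_all add: g_def)
  have "(\<Sum>j<q. g j) \<le> n + 1"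
  proof (cases q)
    case (Suc p)
    then show ?thesis using g_sum[of p] by simp
  qed simp
  have block: "\<bar>(\<Sum>r<n. y j / real (n * j + r)) - y j / j\<bar> \<le> B * g j" for j
  proof (cases "j = 0")
    case True
    have "\<bar>\<Sum>r<n. y 0 / real r\<bar> \<le> (\<Sum>r<n. B)"
      by (intro order_trans[OF sum_abs] sum_mono term_le)
    with True show ?thesis by (simp add: g_def mult.commute)
  next
    case False
    have "(\<Sum>r<n. y j / real (n * j + r)) - y j / j = y j * ((\<Sum>r<n. 1 / real (n * j + r)) - 1 / j)"
      by (simp add: right_diff_distrib sum_distrib_left)
    then have "\<bar>(\<Sum>r<n. y j / real (n * j + r)) - y j / j\<bar>
        = \<bar>y j\<bar> * \<bar>(\<Sum>r<n. 1 / real (n * j + r)) - 1 / j\<bar>"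
      by (simp add: abs_mult)
    also have "\<dots> \<le> B * g j"
      using False B0 n by (intro mult_mono B) (use block_reciprocal[of j n] in \<open>auto simp: g_def\<close>)
    finally show ?thesis .
  qed
  have "\<bar>S' (n * q) - S q\<bar> = \<bar>\<Sum>j<q. (\<Sum>r<n. y j / real (n * j + r)) - y j / j\<bar>"
    unfolding S'_def S_def by (simp add: sum_dilation_blocks[of "\<lambda>j k. y j / real k"] sum_subtractf)
  also have "\<dots> \<le> (\<Sum>j<q. B * g j)"
    by (intro order_trans[OF sum_abs] sum_mono block)
  also have "\<dots> \<le> B * (n + 1)"
    using \<open>(\<Sum>j<q. g j) \<le> n + 1\<close> B0 by (simp add: sum_distrib_left[symmetric] mult_left_mono)
  finally have 1: "\<bar>S' (n * q) - S q\<bar> \<le> B * (n + 1)" .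
  have N: "n * q \<le> N" "N - n * q < n"
    using n by (auto simp: q_def minus_mult_div_eq_mod)
  have "S' N = S' (n * q) + (\<Sum>k=n * q..<N. y (k div n) / k)"
    unfolding S'_def using N sum.atLeastLessThan_concat[of 0 "n * q" N "\<lambda>k. y (k div n) / k"]
    by (simp add: atLeast0LessThan)
  moreover have "\<bar>\<Sum>k=n * q..<N. y (k div n) / k\<bar> \<le> (\<Sum>k=n * q..<N. B)"
    by (intro order_trans[OF sum_abs] sum_mono term_le)
  moreover have "(\<Sum>k=n * q..<N. B) \<le> B * n"
  proof -
    have "real (N - n * q) * B \<le> real n * B" using N B0 by (intro mult_right_mono; linarith)
    then show ?thesis by (simp add: mult.commute)
  qed
  ultimately have 2: "\<bar>S' N - S' (n * q)\<bar> \<le> B * n" by linarith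
  have "q \<le> N" unfolding q_def by simp
  then have "S N = S q + (\<Sum>k=q..<N. y k / k)"
    unfolding S_def using sum.atLeastLessThan_concat[of 0 q N "\<lambda>k. y k / k"]
    by (simp add: atLeast0LessThan)
  moreover have "\<bar>\<Sum>k=q..<N. y k / k\<bar> \<le> B * (2 * n)"
  proof (cases "q = 0")
    case True
    have "\<bar>\<Sum>k=q..<N. y k / k\<bar> \<le> (\<Sum>k=q..<N. B)"
      by (intro order_trans[OF sum_abs] sum_mono term_le)
    also have "\<dots> = real N * B" using True by simp
    also have "\<dots> \<le> (2 * n) * B" using True N B0 by (intro mult_right_mono) auto
    finally show ?thesis by (simp add: mult.commute)
  next
    case False
    have "\<bar>y k / k\<bar> \<le> B / q" if "k \<in> {q..<N}" for k
      using that False B[of k] by (auto intro!: frac_le B0)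
    then have "\<bar>\<Sum>k=q..<N. y k / k\<bar> \<le> (\<Sum>k=q..<N. B / q)"
      by (intro order_trans[OF sum_abs] sum_mono)
    also have "\<dots> = real (N - q) * (B / q)" by simp
    also have "\<dots> \<le> real (2 * n * q) * (B / q)"
    proof (intro mult_right_mono)
      have "n \<le> n * q" using False by simp
      then show "real (N - q) \<le> real (2 * n * q)" using N by linarith
    qed (use B0 in simp)
    finally show ?thesis using False by (simp add: mult.commute mult.left_commute)
  qed
  ultimately have 3: "\<bar>S N - S q\<bar> \<le> B * (2 * n)" by linarith
  have "\<bar>S' N - S N\<bar> \<le> B * (n + 1) + B * n + B * (2 * n)"
    using 1 2 3 by linarith
  then show ?thesis by (simp add: S_def S'_def algebra_simps)
qed

lemma log_mean_ge:
  assumes "1 \<le> a" "a \<le> b" and c: "\<And>k. a \<le> k \<Longrightarrow> k \<le> b \<Longrightarrow> c \<le> y k"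
  shows "c \<le> log_mean a b y"
proof -
  have W: "0 < (\<Sum>k=a..b. 1 / real k)" using assms by (intro sum_pos) auto
  have "c * (\<Sum>k=a..b. 1 / real k) \<le> (\<Sum>k=a..b. y k / k)"
    unfolding sum_distrib_left using c by (intro sum_mono) (simp add: divide_right_mono)
  with W show ?thesis by (simp add: log_mean_def pos_le_divide_eq)
qed

lemma log_mean_scale: "log_mean a b (\<lambda>k. c * y k) = c * log_mean a b y"
  by (simp add: log_mean_def flip: times_divide_eq_right sum_distrib_left)

lemma log_mean_add: "log_mean a b (\<lambda>k. x k + y k) = log_mean a b x + log_mean a b y"
  by (simp add: log_mean_def add_divide_distrib sum.distrib)

lemma log_mean_le:
  assumes "1 \<le> a" "a \<le> b" and c: "\<And>k. a \<le> k \<Longrightarrow> k \<le> b \<Longrightarrow> y k \<le> c"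
  shows "log_mean a b y \<le> c"
  using log_mean_ge[of a b "- c" "\<lambda>k. - 1 * y k"] assms by (simp only: log_mean_scale) simp

lemma log_window_ge:
  assumes "1 \<le> a" "a \<le> b"
  shows "ln ((real b + 1) / a) \<le> (\<Sum>k=a..b. 1 / real k)"
proof -
  have "ln (real b + 1) - ln a = (\<Sum>k=a..b. ln (real (Suc k)) - ln k)"
    using assms by (subst sum_Suc_diff) (auto simp: add.commute)
  also have "\<dots> \<le> (\<Sum>k=a..b. 1 / real k)"
  proof (rule sum_mono)
    fix k assume "k \<in> {a..b}"
    then have "k \<ge> 1" using assms by auto
    then have "ln (real (Suc k)) - ln k = ln (1 + 1 / real k)"
      by (simp add: field_simps flip: ln_divide_pos)
    also have "\<dots> \<le> 1 / real k" by (rule ln_add_one_self_le_self) simp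
    finally show "ln (real (Suc k)) - ln k \<le> 1 / real k" .
  qed
  finally show ?thesis using assms by (simp add: ln_divide_pos)
qed

lemma log_mean_dilation:
  fixes y :: "nat \<Rightarrow> real"
  assumes B: "\<And>k. \<bar>y k\<bar> \<le> B" and n: "n \<ge> 1" and ab: "1 \<le> a" "a \<le> b"
  shows "\<bar>log_mean a b (dilation n y) - log_mean a b y\<bar>
    \<le> 2 * B * (4 * n + 1) / (\<Sum>k=a..b. 1 / real k)"
proof -
  have W: "0 < (\<Sum>k=a..b. 1 / real k)" using ab by (intro sum_pos) auto
  have split_sum: "(\<Sum>k=a..b. f k) = (\<Sum>k<Suc b. f k) - (\<Sum>k<a. f k)" for f :: "nat \<Rightarrow> real"
    using ab sum.atLeastLessThan_concat[of 0 a "Suc b" f]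
    by (simp add: atLeast0LessThan lessThan_Suc_atMost atLeastLessThanSuc_atLeastAtMost
        atLeast0AtMost del: sum.lessThan_Suc sum.atMost_Suc)
  have "\<bar>(\<Sum>k=a..b. y (k div n) / k) - (\<Sum>k=a..b. y k / k)\<bar> \<le> 2 * B * (4 * n + 1)"
    unfolding split_sum using sum_dilation_near_sum[where y = y and N = "Suc b", OF B n]
      sum_dilation_near_sum[where y = y and N = a, OF B n]
    by linarith
  then show ?thesis using W
    by (simp add: log_mean_def dilation_def divide_right_mono flip: diff_divide_distrib)
qed

text \<open>
  The limit is a cluster point of the logarithmic means over the windows \<open>{a i..b i}\<close>. It extends the
  ordinary limit because the windows move to infinity, it is dilation invariant because \<open>b i / a i\<close> tends
  to infinity, and bounds on the windows pass to it.
\<close>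

lemma dilation_invariant_limit_on_windows:
  fixes a b :: "nat \<Rightarrow> nat"
  assumes a: "filterlim a at_top sequentially" "\<And>i. 1 \<le> a i"
    and ab: "\<And>i. Suc i * a i \<le> b i"
  obtains \<omega> where "generalized_limit \<omega>" "dilation_invariant \<omega>"
    "\<And>y c. Bseq y \<Longrightarrow> (\<And>i k. a i \<le> k \<Longrightarrow> k \<le> b i \<Longrightarrow> c \<le> y k) \<Longrightarrow> c \<le> \<omega> y"
    "\<And>y c. Bseq y \<Longrightarrow> (\<And>i k. a i \<le> k \<Longrightarrow> k \<le> b i \<Longrightarrow> y k \<le> c) \<Longrightarrow> \<omega> y \<le> c"
proof -
  have a_le_b: "a i \<le> b i" for i using ab[of i] by simp
  define W where "W = (\<lambda>i. \<Sum>k=a i..b i. 1 / real k)"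
  define L where "L i = log_mean (a i) (b i)" for i
  note ge = log_mean_ge[OF a(2) a_le_b, folded L_def] and le = log_mean_le[OF a(2) a_le_b, folded L_def]
  obtain B :: "(nat \<Rightarrow> real) \<Rightarrow> real" where B: "\<And>y k. Bseq y \<Longrightarrow> \<bar>y k\<bar> \<le> B y"
  proof -
    have "\<forall>y::nat \<Rightarrow> real. \<exists>K. Bseq y \<longrightarrow> (\<forall>k. \<bar>y k\<bar> \<le> K)" by (auto simp: Bseq_def)
    then show thesis using that by metis
  qed
  have L_bd: "\<bar>L i y\<bar> \<le> B y" if "y \<in> Collect Bseq" for i y
  proof -
    have "- B y \<le> y k" "y k \<le> B y" for k using B[of y k] that by auto
    then have "- B y \<le> L i y" "L i y \<le> B y" by (intro ge le; simp)+
    then show ?thesis by linarith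
  qed
  obtain \<omega> F where F: "F \<noteq> bot" "F \<le> sequentially"
    and "\<And>y. y \<in> Collect Bseq \<Longrightarrow> ((\<lambda>i. L i y) \<longlongrightarrow> \<omega> y) F"
  proof (rule cluster_function[of "Collect Bseq" L B, OF L_bd])
    fix \<omega> F assume "F \<noteq> bot" "F \<le> sequentially"
      "\<And>y. y \<in> Collect Bseq \<Longrightarrow> ((\<lambda>i. L i y) \<longlongrightarrow> \<omega> y) F"
    then show thesis by (rule that)
  qed
  then have lim: "((\<lambda>i. L i y) \<longlongrightarrow> \<omega> y) F" if "Bseq y" for y using that by simp
  have eqI: "\<omega> y = l" if "((\<lambda>i. L i y) \<longlongrightarrow> l) F" "Bseq y" for y l
    using tendsto_unique[OF F(1) lim[OF that(2)] that(1)] .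
  have ge': "c \<le> \<omega> y" if "Bseq y" "\<And>i k. a i \<le> k \<Longrightarrow> k \<le> b i \<Longrightarrow> c \<le> y k" for y c
    by (rule tendsto_lowerbound[OF lim[OF that(1)] _ F(1)]) (intro always_eventually allI ge that(2))
  have le': "\<omega> y \<le> c" if "Bseq y" "\<And>i k. a i \<le> k \<Longrightarrow> k \<le> b i \<Longrightarrow> y k \<le> c" for y c
    by (rule tendsto_upperbound[OF lim[OF that(1)] _ F(1)]) (intro always_eventually allI le that(2))
  have conv: "\<omega> y = l" if y: "y \<longlonglongrightarrow> l" for y l
  proof (rule eqI[OF tendsto_mono[OF F(2)]])
    show "Bseq y" using y convergentI convergent_imp_Bseq by blast
    show "(\<lambda>i. L i y) \<longlonglongrightarrow> l"
    proof (rule LIMSEQ_I)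
      fix e :: real assume "e > 0"
      then obtain N where N: "\<And>k. k \<ge> N \<Longrightarrow> \<bar>y k - l\<bar> < e / 2"
        using LIMSEQ_D[OF y, of "e / 2"] by auto
      from a(1) obtain I where I: "\<And>i. i \<ge> I \<Longrightarrow> a i \<ge> N"
        by (auto simp: filterlim_at_top eventually_sequentially)
      have "norm (L i y - l) < e" if "i \<ge> I" for i
      proof -
        have yk: "l - e / 2 \<le> y k" "y k \<le> l + e / 2" if "a i \<le> k" for k
          using N[of k] I[OF \<open>i \<ge> I\<close>] that by linarith+
        have "l - e / 2 \<le> L i y" "L i y \<le> l + e / 2" by (intro ge le yk; simp)+
        then show ?thesis using \<open>e > 0\<close> by simp
      qed
      then show "\<exists>I. \<forall>i\<ge>I. norm (L i y - l) < e" by blast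
    qed
  qed
  have "generalized_limit \<omega>"
    unfolding generalized_limit_def
  proof (intro conjI allI impI)
    fix x y :: "nat \<Rightarrow> real" assume xy: "Bseq x" "Bseq y"
    from tendsto_add[OF lim[OF xy(1)] lim[OF xy(2)]]
    have "((\<lambda>i. L i (\<lambda>n. x n + y n)) \<longlongrightarrow> \<omega> x + \<omega> y) F" by (simp add: L_def log_mean_add)
    moreover have "Bseq (\<lambda>n. x n + y n)"
    proof (rule BseqI')
      show "norm (x n + y n) \<le> B x + B y" for n
        using B[OF xy(1), of n] B[OF xy(2), of n] by simp
    qed
    ultimately show "\<omega> (\<lambda>n. x n + y n) = \<omega> x + \<omega> y" by (rule eqI)
  next
    fix c and x :: "nat \<Rightarrow> real" assume x: "Bseq x"
    from tendsto_mult_left[OF lim[OF x]]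
    have "((\<lambda>i. L i (\<lambda>n. c * x n)) \<longlongrightarrow> c * \<omega> x) F" by (simp add: L_def log_mean_scale)
    moreover have "Bseq (\<lambda>n. c * x n)" using B[OF x] by (intro BseqI'[of _ "\<bar>c\<bar> * B x"]) (simp add: abs_mult mult_left_mono)
    ultimately show "\<omega> (\<lambda>n. c * x n) = c * \<omega> x" by (rule eqI)
  next
    fix x :: "nat \<Rightarrow> real" assume "Bseq x" "\<forall>n. 0 \<le> x n"
    then show "0 \<le> \<omega> x" by (intro ge') auto
  next
    show "\<omega> (\<lambda>_. 1) = 1" by (rule conv) simp
  next
    fix x :: "nat \<Rightarrow> real" and l assume "x \<longlonglongrightarrow> l"
    then show "\<omega> x = l" by (rule conv)
  qed
  moreover have "dilation_invariant \<omega>"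
    unfolding dilation_invariant_def
  proof (intro allI impI)
    fix n :: nat and y :: "nat \<Rightarrow> real" assume n: "1 \<le> n" and y: "Bseq y"
    have W_ge: "ln (real (Suc i)) \<le> W i" for i
    proof -
      have "real (Suc i) * a i \<le> b i" using ab[of i] by (metis of_nat_le_iff of_nat_mult)
      then have "real (Suc i) \<le> (real (b i) + 1) / a i"
        using a(2)[of i] by (simp add: pos_le_divide_eq)
      then have "ln (real (Suc i)) \<le> ln ((real (b i) + 1) / a i)" by (intro ln_mono) auto
      then show ?thesis using log_window_ge[OF a(2) a_le_b, of i] by (simp add: W_def)
    qed
    have "filterlim (\<lambda>i. ln (real (Suc i))) at_top sequentially"
      by (intro filterlim_compose[OF ln_at_top] filterlim_compose[OF filterlim_real_sequentially] filterlim_Suc)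
    then have "filterlim W at_top sequentially"
      by (rule filterlim_at_top_mono) (intro always_eventually allI W_ge)
    then have err: "(\<lambda>i. 2 * B y * (4 * n + 1) / W i) \<longlonglongrightarrow> 0"
      by (intro tendsto_divide_0[OF tendsto_const] filterlim_at_top_imp_at_infinity)
    have "(\<lambda>i. L i (dilation n y) - L i y) \<longlonglongrightarrow> 0"
      by (rule Lim_null_comparison[OF _ err])
         (use log_mean_dilation[OF B n a(2) a_le_b, OF y] in \<open>auto simp: L_def W_def\<close>)
    from tendsto_add[OF tendsto_mono[OF F(2) this] lim[OF y]]
    have "((\<lambda>i. L i (dilation n y)) \<longlongrightarrow> \<omega> y) F" by simp
    moreover have "Bseq (dilation n y)" using B[OF y] by (auto simp: dilation_def intro!: BseqI')
    ultimately show "\<omega> (dilation n y) = \<omega> y" by (rule eqI)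
  qed
  ultimately show thesis using ge' le' by (rule that)
qed

section \<open>Uniqueness of positive square roots\<close>

lemma positive_form_Cauchy_Schwarz:
  fixes P :: "'a::real_inner \<Rightarrow> 'a"
  assumes "linear P" and sym: "\<And>x y. inner (P x) y = inner x (P y)" and pos: "\<And>x. 0 \<le> inner (P x) x"
  shows "(inner (P x) y)\<^sup>2 \<le> inner (P x) x * inner (P y) y"
proof -
  define a b c where "a = inner (P x) x" and "b = inner (P x) y" and "c = inner (P y) y"
  have b': "inner (P y) x = b" using sym[of y x] by (simp add: b_def inner_commute)
  have q: "0 \<le> a + 2 * t * b + t\<^sup>2 * c" for t
  proof -
    have "inner (P (x + t *\<^sub>R y)) (x + t *\<^sub>R y) = a + 2 * t * b + t\<^sup>2 * c"
      using \<open>linear P\<close> by (simp add: linear_add linear_scale inner_add_left inner_add_right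
        a_def c_def b' power2_eq_square algebra_simps flip: b_def)
    with pos[of "x + t *\<^sub>R y"] show ?thesis by simp
  qed
  have "b\<^sup>2 \<le> a * c"
  proof (cases "c = 0")
    case True
    show ?thesis
    proof (cases "b = 0")
      case False
      with q[of "- (a + 1) / (2 * b)"] True show ?thesis by (simp add: field_simps)
    qed (simp add: True)
  next
    case False
    then have "c > 0" using pos[of y] by (simp add: c_def)
    then have "0 \<le> a - b\<^sup>2 / c" using q[of "- b / c"] by (simp add: power2_eq_square field_simps)
    with \<open>c > 0\<close> show ?thesis by (simp add: field_simps)
  qed
  then show ?thesis by (simp add: a_def b_def c_def)
qed

lemma positive_form_eq_0:
  fixes P :: "'a::real_inner \<Rightarrow> 'a"
  assumes "linear P" and "\<And>x y. inner (P x) y = inner x (P y)" and "\<And>x. 0 \<le> inner (P x) x"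
    and "inner (P x) x = 0"
  shows "P x = 0"
  using positive_form_Cauchy_Schwarz[OF assms(1-3), of x "P x"] assms(4) by simp

text \<open>
  The norms of the powers of the symmetric operator \<open>c + P\<close> at \<open>y\<close> form a log-convex sequence, so their
  successive ratios do not decrease. If \<open>inner (P y) y > 0\<close>, the first ratio already exceeds \<open>c\<close>, and the
  norms outgrow every multiple of \<open>c ^ n\<close>.
\<close>

lemma bounded_powers_imp_form_le_0:
  fixes P :: "'a::real_inner \<Rightarrow> 'a"
  assumes lin: "linear P" and sym: "\<And>x y. inner (P x) y = inner x (P y)"
    and "c > 0" and bd: "\<And>n. norm (((\<lambda>x. c *\<^sub>R x + P x) ^^ n) y) \<le> K * c ^ n"
  shows "inner (P y) y \<le> 0"
proof (rule ccontr)
  assume "\<not> inner (P y) y \<le> 0"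
  then have Py: "inner (P y) y > 0" by simp
  define Q where "Q = (\<lambda>x. c *\<^sub>R x + P x)"
  have symQ: "inner (Q x) z = inner x (Q z)" for x z
    by (simp add: Q_def inner_add_left inner_add_right sym)
  define a where "a n = norm ((Q ^^ n) y)" for n
  have a_log_convex: "a (Suc n) ^ 2 \<le> a n * a (Suc (Suc n))" for n
  proof -
    have "a (Suc n) ^ 2 = inner ((Q ^^ n) y) ((Q ^^ Suc (Suc n)) y)"
      by (simp add: a_def power2_norm_eq_inner symQ)
    also have "\<dots> \<le> a n * a (Suc (Suc n))" unfolding a_def by (rule norm_cauchy_schwarz)
    finally show ?thesis .
  qed
  have "y \<noteq> 0" using Py by auto
  then have a0: "a 0 > 0" by (simp add: a_def)
  have "(c * a 0)\<^sup>2 < (a 1)\<^sup>2"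
  proof -
    have "(a 1)\<^sup>2 = (c * a 0)\<^sup>2 + 2 * c * inner (P y) y + (norm (P y))\<^sup>2"
      unfolding a_def Q_def power_mult_distrib power2_norm_eq_inner
      by (simp add: inner_add_left inner_add_right inner_commute[of y "P y"] power2_eq_square
          algebra_simps del: dot_square_norm)
    moreover have "2 * c * inner (P y) y > 0" using Py \<open>c > 0\<close> by simp
    ultimately show ?thesis using zero_le_power2[of "norm (P y)"] by linarith
  qed
  then have a1: "c * a 0 < a 1"
    by (rule power2_less_imp_less) (simp add: a_def)
  define r where "r = a 1 / a 0"
  have r: "r > c" using a1 a0 by (simp add: r_def pos_less_divide_eq)
  have step: "a n > 0 \<and> r * a n \<le> a (Suc n)" for n
  proof (induction n)
    case 0
    show ?case using a0 by (simp add: r_def)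
  next
    case (Suc n)
    then have "0 < r * a n" using r \<open>c > 0\<close> by simp
    with Suc have pos: "a (Suc n) > 0" by linarith
    have "(r * a n) * a (Suc n) \<le> a (Suc n) ^ 2"
      using Suc pos by (simp add: power2_eq_square)
    also have "\<dots> \<le> a n * a (Suc (Suc n))" by (rule a_log_convex)
    finally have "a n * (r * a (Suc n)) \<le> a n * a (Suc (Suc n))" by (simp add: mult_ac)
    then show ?case using Suc pos by simp
  qed
  have growth: "r ^ n * a 0 \<le> a n" for n
  proof (induction n)
    case (Suc n)
    have "r ^ Suc n * a 0 = r * (r ^ n * a 0)" by simp
    also have "\<dots> \<le> r * a n" using Suc r \<open>c > 0\<close> by (intro mult_left_mono) auto
    also have "\<dots> \<le> a (Suc n)" using step by blast
    finally show ?case .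
  qed simp
  then have "r ^ n * a 0 \<le> K * c ^ n" for n
    using order_trans[OF growth[of n]] bd[of n] by (simp add: a_def Q_def)
  then have le: "(r / c) ^ n \<le> K / a 0" for n
    using a0 \<open>c > 0\<close> by (simp add: power_divide field_simps)
  obtain n where "K / a 0 < (r / c) ^ n"
    using real_arch_pow[of "r / c" "K / a 0"] r \<open>c > 0\<close> by auto
  with le[of n] show False by simp
qed

text \<open>
  With \<open>P = S + T\<close> and \<open>D = S - T\<close>, the equality of the squares says \<open>P D = - D P\<close>. Hence
  \<open>(c + P)^n D = D (c - P)^n\<close>, and for \<open>c \<ge> \<parallel>P\<parallel>\<close> the powers of \<open>(c - P) / c\<close> are contractions. The growth
  lemma gives \<open>inner (P y) y \<le> 0\<close> for \<open>y = D x\<close>, so that \<open>S y = T y = 0\<close> and \<open>D (D x) = 0\<close>.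
\<close>

lemma positive_square_root_unique_real:
  fixes S T :: "'a::real_inner \<Rightarrow> 'a"
  assumes blS: "bounded_linear S" and blT: "bounded_linear T"
    and symS: "\<And>x y. inner (S x) y = inner x (S y)" and symT: "\<And>x y. inner (T x) y = inner x (T y)"
    and posS: "\<And>x. 0 \<le> inner (S x) x" and posT: "\<And>x. 0 \<le> inner (T x) x"
    and eq: "\<And>x. S (S x) = T (T x)"
  shows "S = T"
proof
  fix x
  note linS = bounded_linear.linear[OF blS] and linT = bounded_linear.linear[OF blT]
  define P where "P = (\<lambda>x. S x + T x)"
  define D where "D = (\<lambda>x. S x - T x)"
  have blP: "bounded_linear P" and blD: "bounded_linear D"
    unfolding P_def D_def using blS blT by (auto intro: bounded_linear_add bounded_linear_sub)
  note linP = bounded_linear.linear[OF blP] and linD = bounded_linear.linear[OF blD]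
  have symP: "inner (P x) y = inner x (P y)" for x y
    by (simp add: P_def inner_add_left inner_add_right symS symT)
  have symD: "inner (D x) y = inner x (D y)" for x y
    by (simp add: D_def inner_diff_left inner_diff_right symS symT)
  have posP: "0 \<le> inner (P x) x" for x
    using posS[of x] posT[of x] by (simp add: P_def inner_add_left)
  have anti: "P (D x) = - D (P x)" for x
    using eq by (simp add: P_def D_def linear_diff[OF linS] linear_diff[OF linT]
        linear_add[OF linS] linear_add[OF linT])
  \<comment> \<open>The summand \<open>1\<close> makes \<open>c\<close> positive even if \<open>P = 0\<close>.\<close>
  define c where "c = onorm P + 1"
  have "c > 0" using onorm_pos_le[OF blP] by (simp add: c_def)
  have contr: "norm (c *\<^sub>R x - P x) \<le> c * norm x" for x
  proof -
    have "(norm (P x))\<^sup>2 * (norm (P x))\<^sup>2 \<le> inner (P x) x * inner (P (P x)) (P x)"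
      using positive_form_Cauchy_Schwarz[OF linP symP posP, of x "P x"]
      by (simp add: power2_norm_eq_inner) (simp add: power2_eq_square)
    also have "\<dots> \<le> inner (P x) x * (c * (norm (P x))\<^sup>2)"
    proof (intro mult_left_mono posP)
      have "inner (P (P x)) (P x) \<le> norm (P (P x)) * norm (P x)" by (rule norm_cauchy_schwarz)
      also have "\<dots> \<le> (onorm P * norm (P x)) * norm (P x)"
        by (intro mult_right_mono onorm[OF blP]) simp
      also have "\<dots> \<le> c * (norm (P x))\<^sup>2" by (simp add: c_def power2_eq_square algebra_simps)
      finally show "inner (P (P x)) (P x) \<le> c * (norm (P x))\<^sup>2" .
    qed
    finally have "(norm (P x))\<^sup>2 * (norm (P x))\<^sup>2 \<le> (c * inner (P x) x) * (norm (P x))\<^sup>2"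
      by (simp add: mult_ac)
    then have "(norm (P x))\<^sup>2 \<le> c * inner (P x) x"
      using posP[of x] \<open>c > 0\<close>
      by (cases "P x = 0") (simp, rule mult_right_le_imp_le[of _ "(norm (P x))\<^sup>2"], simp_all)
    moreover have "c * inner (P x) x \<ge> 0" using posP[of x] \<open>c > 0\<close> by simp
    moreover have "(norm (c *\<^sub>R x - P x))\<^sup>2 = (c * norm x)\<^sup>2 - 2 * (c * inner (P x) x) + (norm (P x))\<^sup>2"
      by (simp add: power2_norm_eq_inner power_mult_distrib inner_diff_left inner_diff_right inner_commute)
         (simp add: power2_eq_square algebra_simps)
    ultimately have "(norm (c *\<^sub>R x - P x))\<^sup>2 \<le> (c * norm x)\<^sup>2" by linarith
    then show ?thesis by (rule power2_le_imp_le) (use \<open>c > 0\<close> in simp)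
  qed
  have inter: "((\<lambda>x. c *\<^sub>R x + P x) ^^ n) (D x) = D (((\<lambda>x. c *\<^sub>R x - P x) ^^ n) x)" for n x
    by (induction n) (simp_all add: anti linear_diff[OF linD] linear_scale[OF linD])
  have contr_pow: "norm (((\<lambda>x. c *\<^sub>R x - P x) ^^ n) x) \<le> c ^ n * norm x" for n x
  proof (induction n)
    case (Suc n)
    have "norm (((\<lambda>x. c *\<^sub>R x - P x) ^^ Suc n) x) \<le> c * norm (((\<lambda>x. c *\<^sub>R x - P x) ^^ n) x)"
      using contr by simp
    also have "\<dots> \<le> c * (c ^ n * norm x)" using Suc \<open>c > 0\<close> by simp
    finally show ?case by simp
  qed simp
  have "inner (P (D x)) (D x) \<le> 0"
  proof (rule bounded_powers_imp_form_le_0[OF linP symP \<open>c > 0\<close>])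
    fix n
    have "norm (((\<lambda>x. c *\<^sub>R x + P x) ^^ n) (D x)) \<le> onorm D * norm (((\<lambda>x. c *\<^sub>R x - P x) ^^ n) x)"
      unfolding inter by (rule onorm[OF blD])
    also have "\<dots> \<le> onorm D * (c ^ n * norm x)"
      by (intro mult_left_mono contr_pow onorm_pos_le[OF blD])
    finally show "norm (((\<lambda>x. c *\<^sub>R x + P x) ^^ n) (D x)) \<le> (onorm D * norm x) * c ^ n"
      by (simp add: mult_ac)
  qed
  then have "inner (S (D x)) (D x) = 0" "inner (T (D x)) (D x) = 0"
    using posS[of "D x"] posT[of "D x"] by (auto simp: P_def inner_add_left)
  then have "S (D x) = 0" "T (D x) = 0"
    using positive_form_eq_0 linS linT symS symT posS posT by blast+
  then have "D (D x) = 0" by (simp add: D_def)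
  then have "inner (D x) (D x) = 0" using symD[of x "D x"] by simp
  then show "S x = T x" by (simp add: D_def)
qed

text \<open>
  Polarization: the form is real at \<open>x + y\<close> and at \<open>x + \<i> y\<close>, which determines the imaginary and the real
  part of \<open>cinner (T x) y\<close> in terms of \<open>cinner (T y) x\<close>.
\<close>

lemma positive_op_hermitian:
  assumes "positive_op T"
  shows "cinner (T x) y = cinner x (T y)"
proof -
  from assms have bl: "bounded_linear T" and sc: "\<And>c x. T (c *\<^sub>C x) = c *\<^sub>C T x"
    and real: "\<And>x. Im (cinner (T x) x) = 0"
    by (auto simp: positive_op_def bounded_clinear_def complex_nonneg_Reals_iff)
  have add: "T (x + y) = T x + T y" for x y by (rule linear_add[OF bounded_linear.linear[OF bl]])
  have add_right: "cinner z (x + y) = cinner z x + cinner z y" for z x y :: 'a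
    by (metis cinner_add_left cinner_commute complex_cnj_add)
  have sc_right: "cinner x (c *\<^sub>C y) = cnj c * cinner x y" for c and x y :: 'a
    by (metis cinner_scaleC_left cinner_commute complex_cnj_mult)
  note expand = add sc cinner_add_left add_right cinner_scaleC_left sc_right
  have "Im (cinner (T x) y) + Im (cinner (T y) x) = 0"
    using real[of "x + y"] real[of x] real[of y] by (simp add: expand)
  moreover have "Re (cinner (T x) y) = Re (cinner (T y) x)"
    using real[of "x + \<i> *\<^sub>C y"] real[of x] real[of y] by (simp add: expand)
  ultimately have "cinner (T x) y = cnj (cinner (T y) x)" by (simp add: complex_eq_iff)
  then show ?thesis by (metis cinner_commute)
qed

lemma positive_op_inner:
  assumes "positive_op T"
  shows "bounded_linear T" "inner (T x) y = inner x (T y)" "0 \<le> inner (T x) x"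
  using assms positive_op_hermitian[OF assms, of x y]
  by (auto simp: positive_op_def bounded_clinear_def inner_eq_Re_cinner complex_nonneg_Reals_iff)

lemma adj_positive_op:
  assumes T: "positive_op T"
  shows "adj T = T"
  unfolding adj_def
proof (rule the_equality)
  fix S :: "'a \<Rightarrow> 'a"
  assume "bounded_clinear S \<and> (\<forall>x y. cinner (T x) y = cinner x (S y))"
  then have "cinner x (S y) = cinner x (T y)" for x y
    using positive_op_hermitian[OF T, of x y] by simp
  then have "inner x (S y - T y) = 0" for x y by (simp add: inner_diff_right) (simp add: inner_eq_Re_cinner)
  then have "S y - T y = 0" for y by (metis inner_eq_zero_iff)
  then show "S = T" by auto
qed (use T positive_op_hermitian[OF T] in \<open>auto simp: positive_op_def\<close>)

lemma abs_op_positive_op: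
  assumes T: "positive_op T"
  shows "abs_op T = T"
  unfolding abs_op_def adj_positive_op[OF T]
proof (rule the_equality)
  fix S :: "'a \<Rightarrow> 'a"
  assume S: "positive_op S \<and> S \<circ> S = T \<circ> T"
  then have "positive_op S" and "\<And>x. S (S x) = T (T x)" by (simp_all add: fun_eq_iff)
  with T show "S = T"
    by (intro positive_square_root_unique_real positive_op_inner)
qed (use T in simp)

lemma positive_op_0: "positive_op (\<lambda>x. 0)"
proof -
  have "cinner 0 x = 0" for x :: 'a using cinner_add_left[of 0 0 x] by simp
  then show ?thesis
    by (simp add: positive_op_def bounded_clinear_def complex_vector.scale_zero_right)
qed

section \<open>Singular values of compact positive operators\<close>

text \<open>
  Eigenvectors of distinct eigenvalues are orthogonal. So if these are unit vectors and the eigenvalues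
  are at least \<open>e\<close>, their images are at distance at least \<open>e\<close> from each other, and the compact closure of
  the image of the unit ball has room for only finitely many of them.
\<close>

lemma finite_eigenvalues_above:
  fixes T :: "'h::complex_hilbert_space \<Rightarrow> 'h"
  assumes T: "compact_op T" "positive_op T" and e: "e > 0"
  shows "finite {l. e \<le> l \<and> 0 < cdim (eigenspace T (complex_of_real l))}"
proof (rule ccontr)
  define E where "E = {l. e \<le> l \<and> 0 < cdim (eigenspace T (complex_of_real l))}"
  assume "\<not> finite {l. e \<le> l \<and> 0 < cdim (eigenspace T (complex_of_real l))}"
  then have "infinite E" by (simp add: E_def)
  have "\<exists>v. norm v = 1 \<and> T v = l *\<^sub>R v" if "l \<in> E" for l
  proof -
    have "\<not> eigenspace T (complex_of_real l) \<subseteq> {0}"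
    proof
      assume "eigenspace T (complex_of_real l) \<subseteq> {0}"
      then have "cdim (eigenspace T (complex_of_real l)) \<le> card ({} :: 'h set)"
        by (intro complex_vector.dim_le_card) auto
      with that show False by (simp add: E_def)
    qed
    then obtain v where "v \<noteq> 0" and v: "T v = l *\<^sub>R v"
      by (auto simp: eigenspace_def scaleR_scaleC)
    have "T ((1 / norm v) *\<^sub>R v) = l *\<^sub>R (1 / norm v) *\<^sub>R v"
      using v by (simp add: linear_scale[OF bounded_linear.linear[OF positive_op_inner(1)[OF T(2)]]])
    with \<open>v \<noteq> 0\<close> show ?thesis by (intro exI[of _ "(1 / norm v) *\<^sub>R v"]) simp
  qed
  then obtain v where v: "\<And>l. l \<in> E \<Longrightarrow> norm (v l) = 1" "\<And>l. l \<in> E \<Longrightarrow> T (v l) = l *\<^sub>R v l"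
    by metis
  define f where "f l = T (v l)" for l
  have sep: "e \<le> dist (f l) (f l')" if "l \<in> E" "l' \<in> E" "l \<noteq> l'" for l l'
  proof -
    have "l * inner (v l) (v l') = l' * inner (v l) (v l')"
      using positive_op_inner(2)[OF T(2), of "v l" "v l'"] v that by simp
    then have orth: "inner (v l) (v l') = 0" using \<open>l \<noteq> l'\<close> by simp
    have "(dist (f l) (f l'))\<^sup>2 = (norm (f l))\<^sup>2 + (norm (f l'))\<^sup>2"
      using v that orth
      unfolding dist_norm f_def power2_norm_eq_inner
      by (simp add: inner_diff_left inner_diff_right inner_commute)
    also have "\<dots> = l\<^sup>2 + l'\<^sup>2" using v that by (simp add: f_def power_mult_distrib)
    also have "\<dots> \<ge> e\<^sup>2"
      using that e power_mono[of e l 2] by (simp add: E_def add_increasing2)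
    finally show ?thesis by (rule power2_le_imp_le) simp
  qed
  have "inj_on f E"
    using sep e by (force intro!: inj_onI)
  then have "infinite (f ` E)" using \<open>infinite E\<close> finite_imageD by blast
  moreover have "f ` E \<subseteq> closure (T ` cball 0 1)"
    using v(1) closure_subset[of "T ` cball 0 1"] by (force simp: f_def)
  moreover have "compact (closure (T ` cball 0 1))" using T(1) by (simp add: compact_op_def)
  ultimately obtain z where "z islimpt f ` E"
    unfolding compact_eq_Bolzano_Weierstrass by blast
  then have "infinite (f ` E \<inter> ball z (e / 2))" using e by (simp add: islimpt_eq_infinite_ball)
  then obtain p where p: "p \<in> f ` E \<inter> ball z (e / 2)" and "infinite (f ` E \<inter> ball z (e / 2) - {p})"
    by (metis finite.emptyI finite_Diff_insert Diff_empty all_not_in_conv)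
  then obtain q where "q \<in> f ` E \<inter> ball z (e / 2) - {p}" by (metis finite.emptyI all_not_in_conv)
  with p have pq: "p \<in> f ` E \<inter> ball z (e / 2)" "q \<in> f ` E \<inter> ball z (e / 2)" "p \<noteq> q" by auto
  then have "dist p q < e" using dist_triangle_half_l[of p z e q] by (auto simp: dist_commute)
  moreover have "e \<le> dist p q" using pq sep by auto
  ultimately show False by simp
qed

lemma finite_initial_segment:
  fixes S :: "nat set"
  assumes "finite S" and "\<And>i j. j \<in> S \<Longrightarrow> i \<le> j \<Longrightarrow> i \<in> S"
  shows "S = {..<card S}"
proof -
  have "\<exists>n. n \<notin> S" using assms(1) by (metis finite_nat_set_iff_bounded less_irrefl)
  define n where "n = (LEAST n. n \<notin> S)"
  have "n \<notin> S" unfolding n_def using \<open>\<exists>n. n \<notin> S\<close> by (rule LeastI_ex)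
  moreover have "i \<in> S" if "i < n" for i using that not_less_Least n_def by blast
  ultimately have "S = {..<n}" using assms(2) by (auto simp: not_le intro: leI)
  then show ?thesis by simp
qed

text \<open>
  For \<open>e > 0\<close> the indices with \<open>e \<le> m j\<close> form an initial segment whose length is the sum of the
  multiplicities of the values above \<open>e\<close>, and these segments determine \<open>m\<close>.
\<close>

lemma decreasing_list_with_multiplicities_unique:
  fixes m m' :: "nat \<Rightarrow> real" and d :: "real \<Rightarrow> nat"
  assumes fin: "\<And>e. e > 0 \<Longrightarrow> finite {l. e \<le> l \<and> 0 < d l}"
    and m: "decseq m \<and> (\<forall>j. 0 \<le> m j) \<and> (\<forall>l>0. finite {j. m j = l} \<and> card {j. m j = l} = d l)"
    and m': "decseq m' \<and> (\<forall>j. 0 \<le> m' j) \<and> (\<forall>l>0. finite {j. m' j = l} \<and> card {j. m' j = l} = d l)"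
  shows "m = m'"
proof -
  have key: "{j. e \<le> m j} = {..<(\<Sum>l | e \<le> l \<and> 0 < d l. d l)}"
    if m: "decseq m \<and> (\<forall>j. 0 \<le> m j) \<and> (\<forall>l>0. finite {j. m j = l} \<and> card {j. m j = l} = d l)"
      and e: "e > 0" for m :: "nat \<Rightarrow> real" and e
  proof -
    let ?E = "{l. e \<le> l \<and> 0 < d l}"
    have mult: "finite {j. m j = l}" "card {j. m j = l} = d l" if "l \<in> ?E" for l
      using m that e by auto
    have "m j \<in> ?E" if "e \<le> m j" for j
    proof -
      have "finite {i. m i = m j}" "card {i. m i = m j} = d (m j)" using m that e by auto
      moreover have "j \<in> {i. m i = m j}" by simp
      ultimately have "0 < d (m j)" by (metis card_gt_0_iff empty_iff)
      with that show ?thesis by simp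
    qed
    then have eq: "{j. e \<le> m j} = (\<Union>l\<in>?E. {j. m j = l})" by auto
    have "card {j. e \<le> m j} = (\<Sum>l\<in>?E. card {j. m j = l})"
      unfolding eq using fin[OF e] mult by (intro card_UN_disjoint) auto
    also have "\<dots> = (\<Sum>l\<in>?E. d l)" using mult by (intro sum.cong) auto
    finally have card: "card {j. e \<le> m j} = (\<Sum>l\<in>?E. d l)" .
    have "finite {j. e \<le> m j}" unfolding eq using fin[OF e] mult by auto
    moreover have "e \<le> m i" if "e \<le> m j" "i \<le> j" for i j
      using decseqD[of m i j] m that by linarith
    ultimately have "{j. e \<le> m j} = {..<card {j. e \<le> m j}}"
      by (intro finite_initial_segment) auto
    then show ?thesis by (simp add: card)
  qed
  have iff: "e \<le> m j \<longleftrightarrow> e \<le> m' j" if "e > 0" for e j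
    using key[OF m that] key[OF m' that] by blast
  show ?thesis
  proof
    fix j
    have "0 \<le> m j" "0 \<le> m' j" using m m' by auto
    then show "m j = m' j"
      using iff[of "m j" j] iff[of "m' j" j] by (cases "m j = 0"; cases "m' j = 0") auto
  qed
qed

text \<open>
  The value \<open>l\<close> occupies the indices from \<open>M l\<close>, the number of entries greater than \<open>l\<close>, up to but not
  including \<open>M l + d l\<close>. These intervals are disjoint; an index in none of them gets the value \<open>0\<close>.
\<close>

lemma decreasing_list_with_multiplicities_exists:
  fixes d :: "real \<Rightarrow> nat"
  assumes fin: "\<And>e. e > 0 \<Longrightarrow> finite {l. e \<le> l \<and> 0 < d l}"
  shows "\<exists>m :: nat \<Rightarrow> real. decseq m \<and> (\<forall>j. 0 \<le> m j) \<and>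
    (\<forall>l>0. finite {j. m j = l} \<and> card {j. m j = l} = d l)"
proof -
  define G where "G l = {x. l < x \<and> 0 < d x}" for l
  define M where "M l = sum d (G l)" for l
  define I where "I l j \<longleftrightarrow> 0 < l \<and> M l \<le> j \<and> j < M l + d l" for l j
  have finG: "finite (G l)" if "l > 0" for l
    by (rule finite_subset[OF _ fin[OF that]]) (auto simp: G_def)
  have M_step: "M l' + d l' \<le> M l" if "0 < l" "l < l'" for l l'
  proof (cases "d l' = 0")
    case True
    have "G l' \<subseteq> G l" using that by (auto simp: G_def)
    with True show ?thesis using finG that by (simp add: M_def sum_mono2)
  next
    case False
    have "l' \<notin> G l'" "insert l' (G l') \<subseteq> G l" using that False by (auto simp: G_def)
    then have "sum d (insert l' (G l')) \<le> M l"
      unfolding M_def using finG that by (intro sum_mono2) auto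
    with \<open>l' \<notin> G l'\<close> show ?thesis using finG that by (simp add: M_def)
  qed
  have I_unique: "l = l'" if "I l j" "I l' j" for l l' j
    using M_step[of l l'] M_step[of l' l] that by (cases l l' rule: linorder_cases) (auto simp: I_def)
  define m where "m j = (if \<exists>l. I l j then THE l. I l j else 0)" for j
  have m_I: "m j = l" if "I l j" for l j
    unfolding m_def using that I_unique by (auto intro!: the_equality)
  have m_0: "m j = 0" if "\<And>l. \<not> I l j" for j using that by (simp add: m_def)
  have nonneg: "0 \<le> m j" for j
  proof (cases "\<exists>l. I l j")
    case True
    then obtain l where "I l j" by blast
    with m_I[OF this] show ?thesis by (simp add: I_def)
  qed (simp add: m_0)
  have level: "{j. m j = l} = {M l..<M l + d l}" if "l > 0" for l
  proof -
    have "I l j" if "m j = l" for j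
    proof -
      obtain l' where "I l' j" using m_0[of j] \<open>m j = l\<close> \<open>l > 0\<close> by fastforce
      with m_I[OF this] \<open>m j = l\<close> show ?thesis by simp
    qed
    then have "{j. m j = l} = {j. I l j}" using m_I by blast
    also have "\<dots> = {M l..<M l + d l}" using \<open>l > 0\<close> by (auto simp: I_def)
    finally show ?thesis .
  qed
  have "m j \<le> m i" if "i \<le> j" for i j
  proof (cases "\<exists>l. I l j")
    case False
    then show ?thesis using m_0[of j] nonneg[of i] by simp
  next
    case True
    then obtain l where l: "I l j" by blast
    then have "l > 0" by (simp add: I_def)
    \<comment> \<open>The interval that contains \<open>i\<close> belongs to the largest value whose interval ends after \<open>i\<close>.\<close>
    define A where "A = {x. l \<le> x \<and> 0 < d x \<and> i < M x + d x}"
    have "finite A" by (rule finite_subset[OF _ fin[OF \<open>l > 0\<close>]]) (auto simp: A_def)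
    have "l \<in> A" using l that by (auto simp: A_def I_def)
    define x where "x = Max A"
    have "x \<in> A" unfolding x_def using \<open>finite A\<close> \<open>l \<in> A\<close> by (intro Max_in) auto
    then have "0 < x" using \<open>l > 0\<close> by (auto simp: A_def)
    have "M x \<le> i"
    proof (rule ccontr)
      assume "\<not> M x \<le> i"
      then have "G x \<noteq> {}" by (auto simp: M_def)
      define y where "y = Min (G x)"
      have "y \<in> G x" unfolding y_def using finG[OF \<open>0 < x\<close>] \<open>G x \<noteq> {}\<close> by (rule Min_in)
      have "G x = insert y (G y)"
        using \<open>y \<in> G x\<close> Min_le[OF finG[OF \<open>0 < x\<close>]] unfolding y_def[symmetric]
        by (force simp: G_def)
      moreover have "y \<notin> G y" by (simp add: G_def)
      moreover have "finite (G y)" using \<open>y \<in> G x\<close> \<open>0 < x\<close> by (intro finG) (simp add: G_def)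
      ultimately have "M x = M y + d y" by (simp add: M_def)
      with \<open>\<not> M x \<le> i\<close> \<open>y \<in> G x\<close> \<open>x \<in> A\<close> have "y \<in> A" by (auto simp: A_def G_def)
      then have "y \<le> x" unfolding x_def using \<open>finite A\<close> by simp
      with \<open>y \<in> G x\<close> show False by (simp add: G_def)
    qed
    with \<open>x \<in> A\<close> \<open>0 < x\<close> have "I x i" by (simp add: I_def A_def)
    then show ?thesis using m_I[OF l] m_I[of x i] \<open>x \<in> A\<close> by (simp add: A_def)
  qed
  then have "decseq m" by (simp add: decseq_def)
  with nonneg level show ?thesis by (intro exI[of _ m]) auto
qed

lemma singular_values_positive_op:
  fixes T :: "'h::complex_hilbert_space \<Rightarrow> 'h"
  assumes T: "positive_op T"
    and fin: "\<And>e. e > 0 \<Longrightarrow> finite {l. e \<le> l \<and> 0 < cdim (eigenspace T (complex_of_real l))}"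
  shows "decseq (\<lambda>k. singular_value k T) \<and> (\<forall>j. 0 \<le> singular_value j T) \<and>
    (\<forall>l>0. finite {j. singular_value j T = l} \<and>
      card {j. singular_value j T = l} = cdim (eigenspace T (complex_of_real l)))"
proof -
  define Q where "Q m \<longleftrightarrow> decseq m \<and> (\<forall>j. 0 \<le> m j) \<and> (\<forall>l>0. finite {j. m j = l} \<and>
    card {j. m j = l} = cdim (eigenspace T (complex_of_real l)))" for m :: "nat \<Rightarrow> real"
  have "\<exists>m. Q m" unfolding Q_def 
    by (rule decreasing_list_with_multiplicities_exists) (rule fin)
  moreover have "m = m'" if "Q m" "Q m'" for m m'
    using that unfolding Q_def 
    by (rule decreasing_list_with_multiplicities_unique[where
          d = "\<lambda>l. cdim (eigenspace T (complex_of_real l))", rotated]) (rule fin)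
  ultimately have "\<exists>!m. Q m" by (rule ex_ex1I)
  then have "Q (THE m. Q m)" by (rule theI')
  moreover have "singular_value k T = (THE m. Q m) k" for k
    unfolding singular_value_def abs_op_positive_op[OF T] Q_def by (rule refl)
  ultimately show ?thesis by (simp add: Q_def)
qed

lemma singular_value_nonneg:
  assumes "compact_op T" "positive_op T"
  shows "0 \<le> singular_value k T"
  using singular_values_positive_op[OF assms(2) finite_eigenvalues_above[OF assms]] by blast

lemma singular_value_0: "singular_value k (\<lambda>x::'h::complex_hilbert_space. 0) = 0"
proof -
  have "cdim (eigenspace (\<lambda>x::'h. 0) (complex_of_real l)) = 0" if "l > 0" for l
  proof -
    have "eigenspace (\<lambda>x::'h. 0) (complex_of_real l) \<subseteq> {0}"
      using that by (auto simp: eigenspace_def simp flip: scaleR_scaleC)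
    then have "cdim (eigenspace (\<lambda>x::'h. 0) (complex_of_real l)) \<le> card ({} :: 'h set)"
      by (intro complex_vector.dim_le_card) auto
    then show ?thesis by simp
  qed
  note dim0 = this
  have fin: "finite {l. e \<le> l \<and> 0 < cdim (eigenspace (\<lambda>x::'h. 0) (complex_of_real l))}" if "e > 0" for e
  proof -
    have "{l. e \<le> l \<and> 0 < cdim (eigenspace (\<lambda>x::'h. 0) (complex_of_real l))} = {}"
      using dim0 that by force
    then show ?thesis by (simp only: finite.emptyI)
  qed
  note sv = singular_values_positive_op[OF positive_op_0 fin]
  show ?thesis
  proof (rule ccontr)
    assume "singular_value k (\<lambda>x::'h. 0) \<noteq> 0"
    with sv have "0 < singular_value k (\<lambda>x::'h. 0)" by (simp add: order_less_le)
    with sv dim0 have "finite {j. singular_value j (\<lambda>x::'h. 0) = singular_value k (\<lambda>x::'h. 0)}"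
      "card {j. singular_value j (\<lambda>x::'h. 0) = singular_value k (\<lambda>x::'h. 0)} = 0"
      by simp_all
    then have "{j. singular_value j (\<lambda>x::'h. 0) = singular_value k (\<lambda>x::'h. 0)} = {}" by simp
    then show False by blast
  qed
qed

lemma singular_mean_0: "singular_mean \<psi> (\<lambda>x. 0) = (\<lambda>n. 0)"
  by (rule ext) (simp add: singular_mean_def singular_value_0)

text \<open>
  For positive \<open>T\<close> all parts of the canonical decomposition vanish except \<open>pos_part (re_op T) = T\<close>.
\<close>

lemma dixmier_trace_positive_op:
  fixes T :: "'h::complex_hilbert_space \<Rightarrow> 'h"
  assumes T: "positive_op T" and \<omega>: "generalized_limit \<omega>"
  shows "dixmier_trace \<psi> \<omega> T = complex_of_real (\<omega> (singular_mean \<psi> T))"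
proof -
  have avg: "(1 / 2) *\<^sub>C (x + x) = x" for x :: 'h
    using scaleC_add_left[of "1 / 2" "1 / 2" x] by (simp add: scaleC_add_right scaleC_one)
  have parts: "pos_part S = S" "neg_part S = (\<lambda>x. 0)" if "positive_op S" for S :: "'h \<Rightarrow> 'h"
    unfolding pos_part_def neg_part_def abs_op_positive_op[OF that] avg diff_self
      complex_vector.scale_zero_right by (rule refl)+
  have re: "re_op T = T"
    unfolding re_op_def adj_positive_op[OF T] avg by (rule refl)
  have im: "im_op T = (\<lambda>x. 0)"
    unfolding im_op_def adj_positive_op[OF T] diff_self complex_vector.scale_zero_right by (rule refl)
  have "\<omega> (\<lambda>n. 0) = 0" using \<omega> unfolding generalized_limit_def by auto
  then show ?thesis
    unfolding dixmier_trace_def dixmier_weight_def re im parts[OF T] parts[OF positive_op_0]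
      singular_mean_0 by (simp add: complex_eq_iff)
qed

section \<open>Sequences that are almost increasing on long windows\<close>

text \<open>
  Values \<open>x n \<ge> c + e\<close> at arbitrarily large \<open>n\<close> propagate to windows to the right of \<open>n\<close> and give a
  limit above \<open>c\<close>; values \<open>x n \<le> c - e\<close> propagate to windows to the left of \<open>n\<close> and give one below.
\<close>

lemma convergent_if_dilation_invariant_limits_agree:
  fixes x :: "nat \<Rightarrow> real"
  assumes pos: "\<And>n. 0 \<le> x n" and bdd: "Bseq x"
    and win: "\<And>M \<delta>. \<delta> > 0 \<Longrightarrow>
      \<exists>N. \<forall>a\<ge>N. \<forall>j k. a \<le> j \<longrightarrow> j \<le> k \<longrightarrow> k + 1 \<le> M * (a + 1) \<longrightarrow> x j \<le> (1 + \<delta>) * x k"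
    and agree: "\<And>\<omega>. generalized_limit \<omega> \<Longrightarrow> dilation_invariant \<omega> \<Longrightarrow> \<omega> x = c"
  shows "x \<longlonglongrightarrow> c"
proof (rule LIMSEQ_I)
  fix e :: real assume "e > 0"
  obtain \<omega>\<^sub>0 where "generalized_limit \<omega>\<^sub>0" "dilation_invariant \<omega>\<^sub>0"
  proof (rule dilation_invariant_limit_on_windows[of Suc "\<lambda>i. Suc i * Suc i", OF filterlim_Suc])
    fix \<omega> assume "generalized_limit \<omega>" "dilation_invariant \<omega>"
    then show thesis by (rule that)
  qed simp_all
  then have "c \<ge> 0" using agree[of \<omega>\<^sub>0] pos bdd by (auto simp: generalized_limit_def)
  \<comment> \<open>Small enough that a factor \<open>1 + \<delta>\<close> moves \<open>c\<close> by less than \<open>e\<close>, also when \<open>c = 0\<close>.\<close>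
  define \<delta> where "\<delta> = e / (c + 1)"
  have "\<delta> > 0" using \<open>e > 0\<close> \<open>c \<ge> 0\<close> by (simp add: \<delta>_def)
  have "\<delta> * c < e" using \<open>e > 0\<close> \<open>c \<ge> 0\<close> by (simp add: \<delta>_def field_simps)
  obtain N where N: "\<And>M a j k. N M \<le> a \<Longrightarrow> a \<le> j \<Longrightarrow> j \<le> k \<Longrightarrow> k + 1 \<le> M * (a + 1) \<Longrightarrow>
      x j \<le> (1 + \<delta>) * x k"
    using win[OF \<open>\<delta> > 0\<close>] by metis
  define R where "R i = max (N (Suc i)) (Suc i)" for i
  have R_limit: "filterlim a at_top sequentially" "\<And>i. 1 \<le> a i" if "\<And>i. R i \<le> a i" for a :: "nat \<Rightarrow> nat"
  proof -
    have "i \<le> a i" for i using that[of i] by (simp add: R_def)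
    then show "filterlim a at_top sequentially"
      by (intro filterlim_at_top_mono[OF filterlim_ident]) simp
    show "1 \<le> a i" for i using that[of i] by (simp add: R_def)
  qed
  \<comment> \<open>Otherwise the windows \<open>{a i..Suc i * a i}\<close> start at large values of \<open>x\<close>.\<close>
  have "\<exists>i. \<forall>n\<ge>R i. x n < c + e"
  proof (rule ccontr)
    assume "\<not> ?thesis"
    then obtain a where a: "\<And>i. R i \<le> a i" "\<And>i. c + e \<le> x (a i)"
      by (metis not_less)
    have low: "(c + e) / (1 + \<delta>) \<le> x k" if "a i \<le> k" "k \<le> Suc i * a i" for i k
    proof -
      have "x (a i) \<le> (1 + \<delta>) * x k"
        using a(1)[of i] that by (intro N[of "Suc i" "a i"]) (auto simp: R_def)
      with a(2)[of i] \<open>\<delta> > 0\<close> show ?thesis by (simp add: field_simps)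
    qed
    obtain \<omega> where "generalized_limit \<omega>" "dilation_invariant \<omega>" "(c + e) / (1 + \<delta>) \<le> \<omega> x"
      using dilation_invariant_limit_on_windows[OF R_limit[OF a(1)], of "\<lambda>i. Suc i * a i"] low bdd
      by (metis order_refl)
    then have "(c + e) / (1 + \<delta>) \<le> c" using agree by simp
    then have "c + e \<le> c + \<delta> * c" using \<open>\<delta> > 0\<close> by (simp add: field_simps)
    with \<open>\<delta> * c < e\<close> show False by simp
  qed
  then obtain i1 where i1: "\<And>n. n \<ge> R i1 \<Longrightarrow> x n < c + e" by blast
  \<comment> \<open>Otherwise the windows \<open>{b i div Suc i..b i}\<close> end at small values of \<open>x\<close>.\<close>
  have "\<exists>i. \<forall>n\<ge>Suc i * R i. c - e < x n"
  proof (rule ccontr)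
    assume "\<not> ?thesis"
    then obtain b where b: "\<And>i. Suc i * R i \<le> b i" "\<And>i. x (b i) \<le> c - e"
      by (metis not_less)
    define a where "a i = b i div Suc i" for i
    have a: "R i \<le> a i" for i
      unfolding a_def using div_le_mono[OF b(1), of i "Suc i"] by (simp del: mult_Suc)
    have up: "x k \<le> (1 + \<delta>) * (c - e)" if "a i \<le> k" "k \<le> b i" for i k
    proof -
      have "b i < Suc i * (a i + 1)"
        using dividend_less_times_div[of "Suc i" "b i"] by (simp add: a_def)
      then have "x k \<le> (1 + \<delta>) * x (b i)"
        using a[of i] that by (intro N[of "Suc i" "a i"]) (auto simp: R_def)
      also have "\<dots> \<le> (1 + \<delta>) * (c - e)" using b(2) \<open>\<delta> > 0\<close> by (intro mult_left_mono) auto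
      finally show ?thesis .
    qed
    have "Suc i * a i \<le> b i" for i by (simp add: a_def del: mult_Suc)
    then obtain \<omega> where "generalized_limit \<omega>" "dilation_invariant \<omega>" "\<omega> x \<le> (1 + \<delta>) * (c - e)"
      using dilation_invariant_limit_on_windows[OF R_limit[OF a], of b] up bdd by metis
    then have "c \<le> (1 + \<delta>) * (c - e)" using agree by simp
    also have "\<dots> = c + \<delta> * c - e - \<delta> * e" by (simp add: algebra_simps)
    also have "\<dots> < c" using \<open>\<delta> * c < e\<close> mult_pos_pos[OF \<open>\<delta> > 0\<close> \<open>e > 0\<close>] by linarith
    finally show False by simp
  qed
  then obtain i2 where i2: "\<And>n. n \<ge> Suc i2 * R i2 \<Longrightarrow> c - e < x n" by blast
  show "\<exists>n0. \<forall>n\<ge>n0. norm (x n - c) < e"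
  proof (intro exI allI impI)
    fix n assume "n \<ge> max (R i1) (Suc i2 * R i2)"
    then show "norm (x n - c) < e" using i1[of n] i2[of n] by (simp add: abs_less_iff del: mult_Suc)
  qed
qed

section \<open>The means as an almost increasing sequence\<close>

lemma Omega_between:
  assumes psi: "\<psi> \<in> Omega" and "0 \<le> s" "s \<le> t" "t < u"
  shows "\<psi> t \<ge> (u - t) / (u - s) * \<psi> s + (t - s) / (u - s) * \<psi> u"
proof -
  define l where "l = (t - s) / (u - s)"
  have l: "0 \<le> l" "l \<le> 1" using assms by (auto simp: l_def)
  have "l * (u - s) = t - s" using assms by (simp add: l_def)
  then have "(1 - l) *\<^sub>R s + l *\<^sub>R u = t" by (simp add: algebra_simps)
  moreover have "1 - l = (u - t) / (u - s)" using assms by (simp add: l_def field_simps)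
  moreover have "concave_on {0..} \<psi>" using psi by (simp add: Omega_def)
  ultimately show ?thesis
    using concave_onD[of "{0..}" \<psi> l s u] l assms by (simp add: l_def)
qed

lemma Omega_unbounded:
  assumes "\<psi> \<in> Omega"
  obtains u where "u > t" "\<psi> u > C"
proof -
  have "eventually (\<lambda>u. \<psi> u > C \<and> u > t) at_top"
    using assms by (intro eventually_conj eventually_gt_at_top)
      (simp add: Omega_def filterlim_at_top_dense)
  then show thesis using that by (metis (no_types, lifting) eventually_at_top_linorder order_refl)
qed

text \<open>
  A concave function that decreases somewhere would stay below its earlier value from then on, but \<open>\<psi>\<close>
  tends to infinity: \<open>\<psi> t\<close> lies above the chord from \<open>s\<close> to some \<open>u > t\<close> with \<open>\<psi> u > \<psi> s\<close>.
\<close>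

lemma Omega_mono:
  assumes psi: "\<psi> \<in> Omega" and "0 \<le> s" "s \<le> t"
  shows "\<psi> s \<le> \<psi> t"
proof -
  obtain u where u: "u > t" "\<psi> u > \<psi> s" using Omega_unbounded[OF psi] .
  have "\<psi> s = (u - t) / (u - s) * \<psi> s + (t - s) / (u - s) * \<psi> s"
  proof -
    have "(u - t) / (u - s) + (t - s) / (u - s) = 1"
      using u assms by (simp flip: add_divide_distrib)
    then show ?thesis by (metis distrib_right mult_1)
  qed
  also have "\<dots> \<le> (u - t) / (u - s) * \<psi> s + (t - s) / (u - s) * \<psi> u"
    using u assms by (intro add_left_mono mult_left_mono) auto
  also have "\<dots> \<le> \<psi> t" using Omega_between[OF assms u(1)] .
  finally show ?thesis .
qed

lemma Omega_pos:
  assumes psi: "\<psi> \<in> Omega" and "t > 0"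
  shows "\<psi> t > 0"
proof -
  obtain u where u: "u > t" "\<psi> u > 0" using Omega_unbounded[OF psi] .
  have "0 < t / u * \<psi> u" using u assms by simp
  also have "\<dots> \<le> (u - t) / u * \<psi> 0 + t / u * \<psi> u"
    using u assms by (simp add: Omega_def)
  also have "\<dots> \<le> \<psi> t" using Omega_between[OF psi, of 0 t u] u assms by simp
  finally show ?thesis .
qed

text \<open>
  Iterating the doubling condition handles the factors \<open>2 ^ m\<close>; monotonicity gives the others, with
  \<open>M \<le> 2 ^ M\<close>.
\<close>

lemma slowly_varying_of_doubling:
  assumes psi: "\<psi> \<in> Omega" and doubling: "((\<lambda>t. \<psi> (2 * t) / \<psi> t) \<longlongrightarrow> 1) at_top"
    and "\<delta> > 0"
  shows "eventually (\<lambda>t. \<psi> (real M * t) \<le> (1 + \<delta>) * \<psi> t) at_top"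
proof -
  have pow: "((\<lambda>t. \<psi> (2 ^ m * t) / \<psi> t) \<longlongrightarrow> 1) at_top" for m :: nat
  proof (induction m)
    case 0
    have "eventually (\<lambda>t. \<psi> (2 ^ 0 * t) / \<psi> t = 1) at_top"
      using eventually_gt_at_top[of 0] by eventually_elim (use Omega_pos[OF psi] in force)
    then show ?case by (rule tendsto_eventually)
  next
    case (Suc m)
    have "filterlim (\<lambda>t::real. 2 ^ m * t) at_top at_top"
      by (rule filterlim_tendsto_pos_mult_at_top[OF tendsto_const _ filterlim_ident]) simp
    from filterlim_compose[OF doubling this]
    have "((\<lambda>t. \<psi> (2 * (2 ^ m * t)) / \<psi> (2 ^ m * t)) \<longlongrightarrow> 1) at_top" .
    from tendsto_mult[OF this Suc]
    have "((\<lambda>t. \<psi> (2 * (2 ^ m * t)) / \<psi> (2 ^ m * t) * (\<psi> (2 ^ m * t) / \<psi> t)) \<longlongrightarrow> 1) at_top"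
      by simp
    moreover have "eventually (\<lambda>t. \<psi> (2 * (2 ^ m * t)) / \<psi> (2 ^ m * t) * (\<psi> (2 ^ m * t) / \<psi> t)
        = \<psi> (2 ^ Suc m * t) / \<psi> t) at_top"
      using eventually_gt_at_top[of 0]
    proof eventually_elim
      case (elim t)
      then have "\<psi> (2 ^ m * t) > 0" by (intro Omega_pos[OF psi]) simp
      then show ?case by (simp add: mult.assoc)
    qed
    ultimately show ?case by (rule Lim_transform_eventually)
  qed
  have "eventually (\<lambda>t. \<psi> (2 ^ M * t) / \<psi> t < 1 + \<delta>) at_top"
    using order_tendstoD(2)[OF pow] \<open>\<delta> > 0\<close> by simp
  then show ?thesis using eventually_gt_at_top[of 0]
  proof eventually_elim
    case (elim t)
    have "real M \<le> 2 ^ M" using less_exp[of M] by (metis less_eq_real_def of_nat_less_numeral_power_cancel_iff)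
    then have "\<psi> (real M * t) \<le> \<psi> (2 ^ M * t)"
      using elim by (intro Omega_mono[OF psi]) (auto intro: mult_right_mono)
    also have "\<dots> \<le> (1 + \<delta>) * \<psi> t"
      using elim Omega_pos[OF psi, of t] by (simp add: pos_divide_less_eq)
    finally show ?case .
  qed
qed

text \<open>
  The numerators increase, and the denominators vary by at most a factor \<open>1 + \<delta>\<close> between \<open>1 + a\<close> and
  \<open>M * (1 + a)\<close>.
\<close>

lemma singular_mean_almost_increasing:
  assumes psi: "\<psi> \<in> Omega" and doubling: "((\<lambda>t. \<psi> (2 * t) / \<psi> t) \<longlongrightarrow> 1) at_top"
    and \<mu>: "\<And>k. 0 \<le> singular_value k T" and "\<delta> > 0"
  shows "\<exists>N. \<forall>a\<ge>N. \<forall>j k. a \<le> j \<longrightarrow> j \<le> k \<longrightarrow> k + 1 \<le> M * (a + 1) \<longrightarrow>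
    singular_mean \<psi> T j \<le> (1 + \<delta>) * singular_mean \<psi> T k"
proof -
  obtain t0 where t0: "\<And>t. t \<ge> t0 \<Longrightarrow> \<psi> (real M * t) \<le> (1 + \<delta>) * \<psi> t"
    using slowly_varying_of_doubling[OF psi doubling \<open>\<delta> > 0\<close>, of M]
    by (auto simp: eventually_at_top_linorder)
  have "singular_mean \<psi> T j \<le> (1 + \<delta>) * singular_mean \<psi> T k"
    if "nat \<lceil>t0\<rceil> \<le> a" "a \<le> j" "j \<le> k" "k + 1 \<le> M * (a + 1)" for a j k
  proof -
    define A where "A n = (\<Sum>i=0..n. singular_value i T)" for n
    have pos: "\<psi> (1 + real n) > 0" for n by (intro Omega_pos[OF psi]) simp
    have "real k + 1 \<le> real M * (real a + 1)"
      using that(4) by (metis of_nat_1 of_nat_add of_nat_le_iff of_nat_mult)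
    then have "\<psi> (1 + real k) \<le> \<psi> (real M * (1 + real a))"
      by (intro Omega_mono[OF psi]) (auto simp: add.commute)
    also have "\<dots> \<le> (1 + \<delta>) * \<psi> (1 + real a)" using that(1) by (intro t0) linarith
    also have "\<dots> \<le> (1 + \<delta>) * \<psi> (1 + real j)"
      using that(2) \<open>\<delta> > 0\<close> by (intro mult_left_mono Omega_mono[OF psi]) auto
    finally have *: "\<psi> (1 + real k) \<le> (1 + \<delta>) * \<psi> (1 + real j)" .
    have "A j \<le> A k" "0 \<le> A j" unfolding A_def using that(3) \<mu> by (auto intro: sum_mono2 sum_nonneg)
    then have "A j * \<psi> (1 + real k) \<le> A k * ((1 + \<delta>) * \<psi> (1 + real j))"
      using * pos[of k] by (intro mult_mono) auto
    then show ?thesis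
      using pos[of j] pos[of k] by (simp add: singular_mean_def flip: A_def) (simp add: field_simps)
  qed
  then show ?thesis by blast
qed

lemma singular_mean_bounded:
  assumes psi: "\<psi> \<in> Omega" and T: "T \<in> marcinkiewicz \<psi>" and \<mu>: "\<And>k. 0 \<le> singular_value k T"
  shows "0 \<le> singular_mean \<psi> T n" "Bseq (singular_mean \<psi> T)"
proof -
  show nonneg: "0 \<le> singular_mean \<psi> T n" for n
    using Omega_pos[OF psi, of "1 + real n"] \<mu> by (simp add: singular_mean_def sum_nonneg)
  have le: "ereal (singular_mean \<psi> T n) \<le> marcinkiewicz_norm \<psi> T" for n
    unfolding marcinkiewicz_norm_def by (rule SUP_upper) simp
  moreover have "marcinkiewicz_norm \<psi> T < \<infinity>" using T by (simp add: marcinkiewicz_def)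
  ultimately obtain C where "marcinkiewicz_norm \<psi> T = ereal C"
    using le[of 0] by (cases "marcinkiewicz_norm \<psi> T") auto
  with le nonneg show "Bseq (singular_mean \<psi> T)" by (intro BseqI'[of _ C]) auto
qed

lemma admissible_if_doubling:
  assumes "((\<lambda>t. \<psi> (2 * t) / \<psi> t) \<longlongrightarrow> 1) at_top" "generalized_limit \<omega>" "dilation_invariant \<omega>"
  shows "admissible \<psi> \<omega>"
  using assms filterlim_compose[OF assms(1) filterlim_real_sequentially]
  by (simp add: admissible_def generalized_limit_def)

theorem theorem3p3:
  fixes \<psi> :: "real \<Rightarrow> real" and T :: "'h::complex_hilbert_space \<Rightarrow> 'h"
  assumes separable: "\<exists>D::'h set. countable D \<and> closure D = UNIV"
    and infinite_dim: "\<not> (\<exists>B::'h set. finite B \<and> cspan B = UNIV)"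
    and psi: "\<psi> \<in> Omega"
    and psi_doubling: "((\<lambda>t. \<psi> (2 * t) / \<psi> t) \<longlongrightarrow> 1) at_top"
    and T: "T \<in> marcinkiewicz \<psi>" and T_pos: "positive_op T"
  shows "dixmier_measurable \<psi> T \<longleftrightarrow>
    convergent (\<lambda>n. 1 / \<psi> (real n + 1) * (\<Sum>k=0..n. singular_value k T))"
proof -
  have "compact_op T" using T by (simp add: marcinkiewicz_def)
  then have \<mu>: "0 \<le> singular_value k T" for k using T_pos by (rule singular_value_nonneg)
  have mean: "(\<lambda>n. 1 / \<psi> (real n + 1) * (\<Sum>k=0..n. singular_value k T)) = singular_mean \<psi> T"
    by (simp add: singular_mean_def fun_eq_iff add.commute)
  have trace: "dixmier_trace \<psi> \<omega> T = complex_of_real (\<omega> (singular_mean \<psi> T))"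
    if "generalized_limit \<omega>" for \<omega>
    using T_pos that by (rule dixmier_trace_positive_op)
  show ?thesis
    unfolding mean
  proof
    assume "dixmier_measurable \<psi> T"
    then obtain c where c: "\<And>\<tau>. \<tau> \<in> dixmier_traces \<psi> \<Longrightarrow> \<tau> T = c"
      by (auto simp: dixmier_measurable_def)
    have "\<omega> (singular_mean \<psi> T) = Re c" if \<omega>: "generalized_limit \<omega>" "dilation_invariant \<omega>" for \<omega>
    proof -
      have "dixmier_trace \<psi> \<omega> \<in> (dixmier_traces \<psi> :: (('h \<Rightarrow> 'h) \<Rightarrow> complex) set)"
        using admissible_if_doubling[OF psi_doubling \<omega>] by (auto simp: dixmier_traces_def)
      from c[OF this] show ?thesis by (auto simp: trace[OF \<omega>(1)])
    qed
    then have "singular_mean \<psi> T \<longlonglongrightarrow> Re c"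
      by (intro convergent_if_dilation_invariant_limits_agree singular_mean_bounded[OF psi T \<mu>]
          singular_mean_almost_increasing[OF psi psi_doubling \<mu>])
    then show "convergent (singular_mean \<psi> T)" by (rule convergentI)
  next
    assume "convergent (singular_mean \<psi> T)"
    then obtain l where "singular_mean \<psi> T \<longlonglongrightarrow> l" by (auto simp: convergent_def)
    then have "\<tau> T = complex_of_real l" if "\<tau> \<in> dixmier_traces \<psi>" for \<tau>
      using that trace by (auto simp: dixmier_traces_def admissible_def generalized_limit_def)
    with T show "dixmier_measurable \<psi> T" by (auto simp: dixmier_measurable_def)
  qed
qed

end
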